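(* For every integer $r\geq 3$ there exists a constant $c=c(r)$ such that for every positive integer $n$ there is a collection $\mathcal{C}$ of $r$-templates of order $n$ with the following properties: (i) every rainbow restricted sum-free $r$-template of order $n$ is a subtemplate of some $P\in\mathcal{C}$; (ii) for every $P\in\mathcal{C}$, $RS(P)\leq n^{-1/3}s([n])$; (iii) $|\mathcal{C}|\leq 2^{c n^{2/3}\log_2^2 n}$.
   Context: An $r$-template of order $n$ is a function $P:[n]\to 2^{[r]}$ assigning to each $x\in[n]$ a set (palette) $P(x)\subseteq[r]$. A template $P_1$ is a subtemplate of $P_2$ if $P_1(x)\subseteq P_2(x)$ for all $x\in[n]$. A restricted Schur triple in $[n]$ is an ordered triple $(a,b,c)$ with $a<b<c$ and $a+b=c$; $s([n])$ is the number of restricted Schur triples in $[n]$. For a template $P$, $RS(P)$ is the number of choices of a restricted Schur triple $(a,b,c)$ in $[n]$ together with pairwise distinct colors $\alpha\in P(a)$, $\beta\in P(b)$, $\gamma\in P(c)$ (i.e. the number of rainbow restricted sums that are subtemplates of $P$). $P$ is rainbow restricted sum-free if $RS(P)=0$. *)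

theory Defs
  imports Complex_Main "HOL-Library.FuncSet"
begin

text \<open>
  \<open>[n]\<close> is \<open>{1..n}\<close>.  Templates are extensional functions (value \<open>undefined\<close> outside \<open>[n]\<close>),
  so that two templates are equal iff they agree on \<open>[n]\<close> and cardinalities of collections of
  templates are the intended ones.
\<close>

definition templates :: "nat \<Rightarrow> nat \<Rightarrow> (nat \<Rightarrow> nat set) set" where
  "templates r n = {1..n} \<rightarrow>\<^sub>E Pow {1..r}"

definition subtemplate :: "nat \<Rightarrow> (nat \<Rightarrow> nat set) \<Rightarrow> (nat \<Rightarrow> nat set) \<Rightarrow> bool" where
  "subtemplate n P Q \<longleftrightarrow> (\<forall>x\<in>{1..n}. P x \<subseteq> Q x)"

definition restricted_schur_triples :: "nat set \<Rightarrow> (nat \<times> nat \<times> nat) set" where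
  "restricted_schur_triples A =
     {(a, b, c). a \<in> A \<and> b \<in> A \<and> c \<in> A \<and> a < b \<and> b < c \<and> a + b = c}"

definition s :: "nat set \<Rightarrow> nat" where
  "s A = card (restricted_schur_triples A)"

definition RS :: "nat \<Rightarrow> (nat \<Rightarrow> nat set) \<Rightarrow> nat" where
  "RS n P = card {((a, b, c), (\<alpha>, \<beta>, \<gamma>)).
     (a, b, c) \<in> restricted_schur_triples {1..n} \<and>
     \<alpha> \<in> P a \<and> \<beta> \<in> P b \<and> \<gamma> \<in> P c \<and> \<alpha> \<noteq> \<beta> \<and> \<beta> \<noteq> \<gamma> \<and> \<alpha> \<noteq> \<gamma>}"

definition rainbow_restricted_sum_free :: "nat \<Rightarrow> (nat \<Rightarrow> nat set) \<Rightarrow> bool" where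
  "rainbow_restricted_sum_free n P \<longleftrightarrow> RS n P = 0"

end

(* Rainbow sum-free templates are the independent sets of a 3-uniform hypergraph on [n] x [r] with
   bounded codegrees, so a container argument applies.  Given a vertex set A spanning m edges, a
   decision tree queries vertices for membership in an unknown independent set I: as long as fewer
   than q vertices of I have been found, it queries a vertex whose link contains d = m/(4N) new
   pairs, N being the number of vertices, and adds d such pairs to an auxiliary graph if the vertex
   lies in I.  If no such vertex is left, the remaining set spans at most 3m/4 edges; if q vertices
   of I have been found, then I is independent in a dense graph with controlled degrees, and the
   Kleitman-Winston argument for that graph removes a constant proportion of the hyperedges.  One
   step costs a factor (N+1)^O(q + N^2/q^2) and needs m >= 4qKN, K bounding the codegrees; O(log n)
   steps with q of order n^(2/3) give the theorem. *)
theory Submission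
  imports Defs
begin

section \<open>Hypergraphs as sets of edges, and double counting\<close>

definition independent :: "'a set set \<Rightarrow> 'a set \<Rightarrow> bool" where
  "independent H I \<longleftrightarrow> (\<forall>h\<in>H. \<not> h \<subseteq> I)"

definition edges_in :: "'a set set \<Rightarrow> 'a set \<Rightarrow> 'a set set" where
  "edges_in H A = {h \<in> H. h \<subseteq> A}"

definition incident :: "'a set set \<Rightarrow> 'a \<Rightarrow> 'a set set" where
  "incident H v = {h \<in> H. v \<in> h}"

lemma sum_card_incident:
  assumes "finite H" "finite U"
  shows "(\<Sum>u\<in>U. card (incident H u)) = (\<Sum>h\<in>H. card (h \<inter> U))"
proof -
  have "(\<Sum>u\<in>U. card (incident H u)) = (\<Sum>u\<in>U. \<Sum>h\<in>H. if u \<in> h then 1 else 0)"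
    using assms by (simp add: incident_def sum.If_cases Int_def)
  also have "\<dots> = (\<Sum>h\<in>H. \<Sum>u\<in>U. if u \<in> h then 1 else 0)"
    by (rule sum.swap)
  also have "\<dots> = (\<Sum>h\<in>H. card (h \<inter> U))"
    using assms by (simp add: sum.If_cases Int_def conj_commute)
  finally show ?thesis .
qed

text \<open>The counting inequality for both decision trees below: with \<open>a\<close> undecided
  vertices after a query and at most \<open>k\<close> acceptances to come, the branch rejecting the
  queried vertex keeps the exponent and the branch accepting it lowers it by one. The left side is
  (a + 1) a^(k-1).\<close>

lemma power_add_power_pred_le:
  fixes a k :: nat
  assumes "k \<ge> 1"
  shows "a ^ k + a ^ (k - 1) \<le> (a + 1) ^ k"
proof -
  obtain j where "k = Suc j" using assms by (cases k) auto
  moreover have "(a + 1) * a ^ j \<le> (a + 1) * (a + 1) ^ j"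
    by (intro mult_left_mono power_mono) auto
  ultimately show ?thesis by (simp add: algebra_simps)
qed

section \<open>Containers for graphs\<close>

text \<open>Kleitman-Winston branching. Query a vertex \<open>v\<close> with at least
  \<open>D\<close> neighbours in the current set: if \<open>v\<close> lies outside \<open>I\<close>,
  only \<open>v\<close> is dropped; if it lies in \<open>I\<close>, its whole neighbourhood is. The
  second answer can occur at most \<open>card A div D\<close> times, which is the exponent.
  Branching ends once all degrees are below \<open>D\<close>.\<close>

lemma graph_containers:
  assumes "finite A" and "D \<ge> 1"
  shows "\<exists>\<D>. finite \<D> \<and> card \<D> \<le> (card A + 1) ^ (card A div D) \<and>
    (\<forall>C\<in>\<D>. C \<subseteq> A \<and> (\<forall>v\<in>C. card {w \<in> C. {v, w} \<in> G} < D)) \<and>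
    (\<forall>I. I \<subseteq> A \<longrightarrow> independent G I \<longrightarrow> (\<exists>C\<in>\<D>. I \<subseteq> C))"
  using assms(1)
proof (induction "card A" arbitrary: A rule: less_induct)
  case less
  show ?case
  proof (cases "\<forall>v\<in>A. card {w \<in> A. {v, w} \<in> G} < D")
    case True
    then show ?thesis by (intro exI[of _ "{A}"]) auto
  next
    case False
    then obtain v where v: "v \<in> A" "D \<le> card {w \<in> A. {v, w} \<in> G}" by force
    define W where "W = {w \<in> A. {v, w} \<in> G}"
    have W: "W \<subseteq> A" "finite W" "D \<le> card W"
      using less.prems v by (auto simp: W_def)
    define a where "a = card A"
    have a_ge: "D \<le> a" "a \<ge> 1"
      using W card_mono[OF less.prems W(1)] assms(2) by (auto simp: a_def)
    have c1: "card (A - {v}) = a - 1" using v less.prems by (simp add: a_def)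
    have c2: "card (A - W) \<le> a - D"
      using W by (simp add: a_def card_Diff_subset)
    have l1: "card (A - {v}) < card A" and l2: "card (A - W) < card A"
      using c1 c2 a_ge assms(2) by (auto simp: a_def)
    obtain \<D>1 where D1: "finite \<D>1" "card \<D>1 \<le> (card (A - {v}) + 1) ^ (card (A - {v}) div D)"
      "\<forall>C\<in>\<D>1. C \<subseteq> A - {v} \<and> (\<forall>v\<in>C. card {w \<in> C. {v, w} \<in> G} < D)"
      "\<forall>I. I \<subseteq> A - {v} \<longrightarrow> independent G I \<longrightarrow> (\<exists>C\<in>\<D>1. I \<subseteq> C)"
      using less.hyps[OF l1] less.prems by auto
    obtain \<D>2 where D2: "finite \<D>2" "card \<D>2 \<le> (card (A - W) + 1) ^ (card (A - W) div D)"
      "\<forall>C\<in>\<D>2. C \<subseteq> A - W \<and> (\<forall>v\<in>C. card {w \<in> C. {v, w} \<in> G} < D)"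
      "\<forall>I. I \<subseteq> A - W \<longrightarrow> independent G I \<longrightarrow> (\<exists>C\<in>\<D>2. I \<subseteq> C)"
      using less.hyps[OF l2] less.prems by auto
    define k where "k = a div D"
    have k: "k \<ge> 1" using a_ge assms(2) by (simp add: k_def Suc_le_eq div_greater_zero_iff)
    have b1: "card \<D>1 \<le> a ^ k"
    proof -
      have "card \<D>1 \<le> a ^ ((a - 1) div D)" using D1(2) c1 a_ge by simp
      also have "\<dots> \<le> a ^ k" unfolding k_def using a_ge
        by (intro power_increasing div_le_mono) auto
      finally show ?thesis .
    qed
    have b2: "card \<D>2 \<le> a ^ (k - 1)"
    proof -
      have "card \<D>2 \<le> a ^ (card (A - W) div D)"
        using D2(2) c2 a_ge assms(2)
        by (elim order_trans) (intro power_mono, auto)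
      also have "\<dots> \<le> a ^ ((a - D) div D)"
        using a_ge c2 by (intro power_increasing div_le_mono) auto
      also have "(a - D) div D = k - 1"
        using a_ge assms(2) by (simp add: k_def le_div_geq)
      finally show ?thesis .
    qed
    have "card (\<D>1 \<union> \<D>2) \<le> a ^ k + a ^ (k - 1)"
      using card_Un_le[of \<D>1 \<D>2] b1 b2 by linarith
    then have card: "card (\<D>1 \<union> \<D>2) \<le> (a + 1) ^ k"
      using power_add_power_pred_le[OF k, of a] by linarith
    have cov: "\<exists>C\<in>\<D>1 \<union> \<D>2. I \<subseteq> C" if I: "I \<subseteq> A" "independent G I" for I
    proof (cases "v \<in> I")
      case True
      then have "I \<subseteq> A - W" using I by (auto simp: W_def independent_def)
      then show ?thesis using D2(4) I by blast
    next
      case False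
      then have "I \<subseteq> A - {v}" using I by auto
      then show ?thesis using D1(4) I by blast
    qed
    show ?thesis
      using card cov D1(1,3) D2(1,3)
      by (intro exI[of _ "\<D>1 \<union> \<D>2"]) (auto simp: a_def k_def)
  qed
qed

lemma card_edges_in_le_of_degree:
  assumes "finite C" and "\<And>g. g \<in> G \<Longrightarrow> card g = 2"
    and "\<And>v. v \<in> C \<Longrightarrow> card {w \<in> C. {v, w} \<in> G} \<le> D"
  shows "card (edges_in G C) \<le> card C * D"
proof -
  have sub: "edges_in G C \<subseteq> (\<Union>v\<in>C. (\<lambda>w. {v, w}) ` {w \<in> C. {v, w} \<in> G})"
  proof
    fix g assume g: "g \<in> edges_in G C"
    then have "card g = 2" using assms(2) by (simp add: edges_in_def)
    then obtain v w where "g = {v, w}" by (auto simp: card_2_iff)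
    then show "g \<in> (\<Union>v\<in>C. (\<lambda>w. {v, w}) ` {w \<in> C. {v, w} \<in> G})"
      using g by (auto simp: edges_in_def)
  qed
  have "card (edges_in G C) \<le> card (\<Union>v\<in>C. (\<lambda>w. {v, w}) ` {w \<in> C. {v, w} \<in> G})"
    using sub assms(1) by (intro card_mono) auto
  also have "\<dots> \<le> (\<Sum>v\<in>C. card ((\<lambda>w. {v, w}) ` {w \<in> C. {v, w} \<in> G}))"
    using assms(1) by (rule card_UN_le)
  also have "\<dots> \<le> (\<Sum>v\<in>C. D)"
    using assms(1,3) by (intro sum_mono) (auto intro: order_trans[OF card_image_le])
  finally show ?thesis by simp
qed

section \<open>One container step for 3-uniform hypergraphs\<close>

locale bounded_codegree =
  fixes V :: "'a set" and H :: "'a set set" and K :: nat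
  assumes finite_V: "finite V"
    and edge_sub: "h \<in> H \<Longrightarrow> h \<subseteq> V"
    and edge_card: "h \<in> H \<Longrightarrow> card h = 3"
    and codegree: "u \<noteq> w \<Longrightarrow> card {h \<in> H. u \<in> h \<and> w \<in> h} \<le> K"
begin

lemma finite_H: "finite H"
  using finite_V edge_sub by (auto intro: finite_subset[of H "Pow V"])

lemma degree_le: "card (incident H v) \<le> K * card V"
proof -
  have "incident H v \<subseteq> (\<Union>w\<in>V - {v}. {h \<in> H. v \<in> h \<and> w \<in> h})"
  proof
    fix h assume h: "h \<in> incident H v"
    then have "card h = 3" by (auto simp: incident_def edge_card)
    then have "h \<noteq> {v}" by auto
    then obtain w where "w \<in> h" "w \<noteq> v" using h by (auto simp: incident_def)
    then show "h \<in> (\<Union>w\<in>V - {v}. {h \<in> H. v \<in> h \<and> w \<in> h})"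
      using h edge_sub by (auto simp: incident_def)
  qed
  then have "card (incident H v) \<le> card (\<Union>w\<in>V - {v}. {h \<in> H. v \<in> h \<and> w \<in> h})"
    using finite_V finite_H by (intro card_mono) auto
  also have "\<dots> \<le> (\<Sum>w\<in>V - {v}. card {h \<in> H. v \<in> h \<and> w \<in> h})"
    using finite_V by (intro card_UN_le) auto
  also have "\<dots> \<le> (\<Sum>w\<in>V - {v}. K)"
    using codegree by (intro sum_mono) auto
  also have "\<dots> \<le> K * card V"
    using finite_V by (simp add: card_mono mult.commute)
  finally show ?thesis .
qed

end

context bounded_codegree
begin

text \<open>This crude bound decides after how many rounds of shrinking no hyperedge can
  remain.\<close>

lemma card_H_le: "card H \<le> K * (card V)\<^sup>2"
proof -
  have "h \<in> (\<Union>v\<in>V. incident H v)" if "h \<in> H" for h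
  proof -
    have "h \<noteq> {}" using edge_card[OF that] by auto
    then show ?thesis using edge_sub[OF that] that by (auto simp: incident_def)
  qed
  then have "H \<subseteq> (\<Union>v\<in>V. incident H v)" by blast
  then have "card H \<le> card (\<Union>v\<in>V. incident H v)"
    using finite_V finite_H by (intro card_mono) (auto simp: incident_def)
  also have "\<dots> \<le> (\<Sum>v\<in>V. card (incident H v))" by (rule card_UN_le[OF finite_V])
  also have "\<dots> \<le> (\<Sum>v\<in>V. K * card V)" using degree_le by (rule sum_mono)
  finally show ?thesis by (simp add: power2_eq_square mult_ac)
qed

end

text \<open>\<open>q\<close> is the number of members of \<open>I\<close> sought, \<open>d\<close>
  the number of pairs each of them contributes, and \<open>p\<close> the exponent reserved for the
  graph containers. \<open>m_ge\<close> keeps the hyperedges meeting the found set few and gives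
  \<open>q * K \<le> d\<close>; \<open>q_le\<close> keeps those over pairs already taken few;
  \<open>q_ge\<close> makes the auxiliary graph large compared with \<open>N * K\<close>;
  \<open>p_ge\<close> bounds the acceptances in the graph by \<open>p\<close>.\<close>

locale container_step = bounded_codegree +
  fixes A :: "'a set" and q p d N m :: nat
  defines "N \<equiv> card V" and "m \<equiv> card (edges_in H A)" and "d \<equiv> m div (4 * N)"
  assumes A_sub: "A \<subseteq> V"
    and K_pos: "K \<ge> 1" and q_pos: "q \<ge> 1"
    and q_le: "2 * K * q \<le> N"
    and q_ge: "4 * N \<le> q\<^sup>2"
    and p_ge: "8 * N\<^sup>2 \<le> p * q\<^sup>2"
    and m_ge: "4 * q * K * N \<le> m"
begin

section \<open>The auxiliary graph collected by the queries\<close>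

definition deg :: "'a \<Rightarrow> nat" where
  "deg u = card (incident (edges_in H A) u)"

text \<open>Capping the degree of \<open>u\<close> in the auxiliary graph in proportion to its degree in the
  hypergraph turns a loss of many graph edges into a loss of many hyperedges.\<close>

definition saturated :: "'a set set \<Rightarrow> 'a \<Rightarrow> bool" where
  "saturated G u \<longleftrightarrow> 4 * q * deg u \<le> N * card (incident G u)"

text \<open>The pairs that may still be added to \<open>G\<close> when \<open>v\<close> turns out to
  lie in \<open>I\<close>. The condition \<open>v \<notin> g\<close> forces
  \<open>card g = 2\<close>: without it \<open>g\<close> could itself be a hyperedge through
  \<open>v\<close>, as then \<open>insert v g = g\<close>.\<close>

definition open_link :: "'a set \<Rightarrow> 'a set set \<Rightarrow> 'a \<Rightarrow> 'a set set" where
  "open_link B G v = {g. insert v g \<in> edges_in H B \<and> v \<notin> g \<and> g \<notin> G \<and> (\<forall>u\<in>g. \<not> saturated G u)}"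

text \<open>Invariant of the queries. The witness in \<open>S\<close> ensures that a set containing
  \<open>S\<close> and independent in \<open>H\<close> is independent in \<open>G\<close> too. The
  slack \<open>N * K\<close> pays for the one batch that pushes a vertex over its cap: by the
  codegree bound a batch adds at most \<open>K\<close> pairs at each vertex.\<close>

definition link_graph :: "'a set \<Rightarrow> 'a set set \<Rightarrow> bool" where
  "link_graph S G \<longleftrightarrow> S \<subseteq> A \<and> (\<forall>g\<in>G. g \<subseteq> A \<and> card g = 2 \<and> (\<exists>v\<in>S. insert v g \<in> H)) \<and>
     card G = d * card S \<and> (\<forall>u. N * card (incident G u) \<le> 4 * q * deg u + N * K)"

lemma finite_A: "finite A"
  using A_sub finite_V finite_subset by blast

lemma finite_edges_in: "finite (edges_in H B)"
  using finite_H by (simp add: edges_in_def)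

lemma N_pos: "N \<ge> 1"
  using q_le K_pos q_pos by (cases N) auto

lemma d_ge: "q * K \<le> d"
proof -
  have "q * K * (4 * N) \<le> m" using m_ge by (simp add: mult_ac)
  then show ?thesis
    unfolding d_def using N_pos by (simp add: less_eq_div_iff_mult_less_eq)
qed

lemma d_pos: "d \<ge> 1"
  using d_ge mult_le_mono[OF q_pos K_pos] by linarith

lemma Nd_le: "4 * N * d \<le> m"
  by (simp add: d_def)

text \<open>Rounding down in \<open>d\<close> costs at most a factor of two, because
  \<open>d \<ge> 1\<close>.\<close>

lemma m_le: "m \<le> 8 * N * d"
proof -
  have "m < 4 * N * (d + 1)"
    unfolding d_def using N_pos dividend_less_times_div[of "4 * N" m] by (simp add: algebra_simps)
  also have "\<dots> \<le> 4 * N * (2 * d)" using d_pos by (intro mult_left_mono) auto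
  finally show ?thesis by simp
qed

lemma finite_graph: "link_graph S G \<Longrightarrow> finite G"
  by (rule finite_subset[of G "Pow A"]) (auto simp: link_graph_def finite_A)

lemma finite_open_link: "finite (open_link B G v)"
  by (rule finite_subset[of _ "Pow V"])
     (use edge_sub finite_V in \<open>auto simp: open_link_def edges_in_def\<close>)

text \<open>The new pairs are disjoint from \<open>G\<close>, so sizes add up. A saturated vertex
  receives no pair, and neither does \<open>v\<close>. At any other vertex \<open>u\<close>, the
  pairs of \<open>L\<close> through \<open>u\<close> extend by \<open>v\<close> to distinct
  hyperedges through \<open>u\<close> and \<open>v\<close>, so there are at most \<open>K\<close> of
  them.\<close>

lemma link_graph_extend:
  assumes G: "link_graph S G" and B: "B \<subseteq> A" and v: "v \<in> B" "v \<notin> S"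
    and L: "L \<subseteq> open_link B G v" "card L = d"
  shows "link_graph (insert v S) (G \<union> L)"
proof -
  have fin: "finite G" "finite L" "finite S"
    using finite_graph[OF G] L(1) finite_open_link finite_subset G finite_A
    by (auto simp: link_graph_def intro: finite_subset)
  have "G \<inter> L = {}" using L(1) by (auto simp: open_link_def)
  then have card: "card (G \<union> L) = d * card (insert v S)"
    using G v(2) fin L(2) by (simp add: card_Un_disjoint link_graph_def)
  have Ledge: "g \<subseteq> A \<and> card g = 2 \<and> insert v g \<in> H" if "g \<in> L" for g
  proof -
    have g: "insert v g \<in> H" "insert v g \<subseteq> B" "v \<notin> g"
      using that L(1) by (auto simp: open_link_def edges_in_def)
    have "finite g" using g(2) B finite_A by (meson finite_insert finite_subset)
    then have "card g = 2" using edge_card[OF g(1)] g(3) by simp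
    then show ?thesis using g B by auto
  qed
  have incL: "card (incident L u) \<le> K" for u
  proof (cases "u = v")
    case True
    then have "incident L u = {}" using L(1) by (auto simp: open_link_def incident_def)
    then show ?thesis by simp
  next
    case False
    have inj: "inj_on (insert v) (incident L u)"
      using L(1) by (auto simp: inj_on_def incident_def open_link_def)
    have "insert v ` incident L u \<subseteq> {h \<in> H. u \<in> h \<and> v \<in> h}"
      using Ledge by (auto simp: incident_def)
    then have "card (insert v ` incident L u) \<le> card {h \<in> H. u \<in> h \<and> v \<in> h}"
      using finite_H by (intro card_mono) auto
    then show ?thesis using codegree[OF False] by (simp add: card_image[OF inj])
  qed
  have cap: "N * card (incident (G \<union> L) u) \<le> 4 * q * deg u + N * K" for u
  proof (cases "saturated G u")
    case True
    then have "incident (G \<union> L) u = incident G u"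
      using L(1) by (auto simp: open_link_def incident_def)
    then show ?thesis using G by (simp add: link_graph_def)
  next
    case False
    have "incident (G \<union> L) u = incident G u \<union> incident L u" by (auto simp: incident_def)
    then have "card (incident (G \<union> L) u) \<le> card (incident G u) + K"
      using card_Un_le[of "incident G u" "incident L u"] incL[of u] by simp
    then have "N * card (incident (G \<union> L) u) \<le> N * (card (incident G u) + K)"
      by (rule mult_left_mono) simp
    then show ?thesis using False by (simp add: saturated_def algebra_simps)
  qed
  show ?thesis
    using G card Ledge cap v B by (auto simp: link_graph_def)
qed

section \<open>Hyperedges surviving at the leaves of the decision tree\<close>

lemma card_edges_le_sum_deg:
  assumes "U \<subseteq> A"
  shows "card {h \<in> edges_in H A. h \<inter> U \<noteq> {}} \<le> (\<Sum>u\<in>U. deg u)"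
proof -
  have fU: "finite U" using assms finite_A finite_subset by blast
  have "{h \<in> edges_in H A. h \<inter> U \<noteq> {}} = (\<Union>u\<in>U. incident (edges_in H A) u)"
    by (auto simp: incident_def)
  then show ?thesis unfolding deg_def using card_UN_le[OF fU] by simp
qed

text \<open>A hyperedge in \<open>B\<close> meets \<open>S\<close>, or meets a saturated vertex, or
  contains a pair of \<open>G\<close>, or consists of a vertex of \<open>B - S\<close> and an open
  pair. These classes have at most m/4, m/8, m/8 and m/4 members, so at most 3m/4 hyperedges
  survive. The weaker ratio 191/192 is the one obtained at the other leaves.\<close>

lemma edges_le_of_stuck:
  assumes G: "link_graph S G" and S: "card S \<le> q" and B: "B \<subseteq> A"
    and stuck: "\<And>v. v \<in> B - S \<Longrightarrow> card (open_link B G v) < d"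
  shows "192 * card (edges_in H B) \<le> 191 * m"
proof -
  have finG: "finite G" by (rule finite_graph[OF G])
  have SA: "S \<subseteq> A" using G by (simp add: link_graph_def)
  have cG: "card G \<le> d * q" using G S by (simp add: link_graph_def)
  define T where "T = {u \<in> A. saturated G u}"
  define E1 where "E1 = {h \<in> edges_in H A. h \<inter> S \<noteq> {}}"
  define E2 where "E2 = {h \<in> edges_in H A. h \<inter> T \<noteq> {}}"
  define E3 where "E3 = (\<Union>g\<in>G. {h \<in> H. g \<subseteq> h})"
  define E4 where "E4 = (\<Union>v\<in>B - S. insert v ` open_link B G v)"
  have finB: "finite B" using B finite_A finite_subset by blast
  have b1: "4 * card E1 \<le> m"
  proof -
    have "card E1 \<le> (\<Sum>u\<in>S. deg u)" unfolding E1_def by (rule card_edges_le_sum_deg[OF SA])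
    also have "\<dots> \<le> (\<Sum>u\<in>S. K * N)"
    proof (rule sum_mono)
      fix u
      have "deg u \<le> card (incident H u)" unfolding deg_def
        using finite_H by (intro card_mono) (auto simp: incident_def edges_in_def)
      then show "deg u \<le> K * N" using degree_le[of u] by (simp add: N_def)
    qed
    also have "\<dots> \<le> q * (K * N)" using S by simp
    finally show ?thesis using m_ge by (simp add: mult_ac)
  qed
  have b2: "8 * card E2 \<le> m"
  proof -
    have fT: "finite T" using finite_A by (simp add: T_def)
    \<comment> \<open>Saturation compares the two degrees: \<open>G\<close> has at most
      \<open>d * q\<close> pairs, hence degree sum at most \<open>2 * d * q\<close>, so the
      saturated vertices have total hypergraph degree at most N d/2, which is at most m/8.\<close>
    have "4 * q * (\<Sum>u\<in>T. deg u) \<le> N * (\<Sum>u\<in>T. card (incident G u))"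
      unfolding sum_distrib_left by (rule sum_mono) (simp add: T_def saturated_def)
    also have "(\<Sum>u\<in>T. card (incident G u)) = (\<Sum>g\<in>G. card (g \<inter> T))"
      by (rule sum_card_incident[OF finG fT])
    also have "\<dots> \<le> (\<Sum>g\<in>G. 2)"
    proof (rule sum_mono)
      fix g assume "g \<in> G"
      then have "card g = 2" using G by (simp add: link_graph_def)
      \<comment> \<open>\<open>card g = 2\<close> also yields finiteness of \<open>g\<close>, since
        infinite sets have cardinality 0.\<close>
      then show "card (g \<inter> T) \<le> 2"
        by (metis card.infinite card_mono inf_le1 zero_neq_numeral)
    qed
    also have "\<dots> \<le> d * q * 2" using cG by simp
    finally have "4 * q * (\<Sum>u\<in>T. deg u) \<le> N * (d * q * 2)" by simp
    then have "q * (2 * (\<Sum>u\<in>T. deg u)) \<le> q * (N * d)" by (simp add: mult_ac)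
    then have "2 * (\<Sum>u\<in>T. deg u) \<le> N * d" using q_pos by (subst (asm) mult_le_cancel1) auto
    moreover have "card E2 \<le> (\<Sum>u\<in>T. deg u)"
      unfolding E2_def by (rule card_edges_le_sum_deg) (auto simp: T_def)
    ultimately show ?thesis using Nd_le by linarith
  qed
  have b3: "8 * card E3 \<le> m"
  proof -
    have "card E3 \<le> (\<Sum>g\<in>G. card {h \<in> H. g \<subseteq> h})"
      unfolding E3_def by (rule card_UN_le[OF finG])
    also have "\<dots> \<le> (\<Sum>g\<in>G. K)"
    proof (rule sum_mono)
      fix g assume "g \<in> G"
      then have "card g = 2" using G by (simp add: link_graph_def)
      then obtain u w where "g = {u, w}" "u \<noteq> w" by (auto simp: card_2_iff)
      then show "card {h \<in> H. g \<subseteq> h} \<le> K" using codegree[of u w] by simp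
    qed
    also have "\<dots> \<le> (d * q) * K" using cG by simp
    finally have "2 * card E3 \<le> d * (2 * K * q)" by (simp add: mult_ac)
    also have "\<dots> \<le> d * N" using q_le by (intro mult_left_mono) auto
    finally show ?thesis using Nd_le by (simp add: mult_ac)
  qed
  have b4: "4 * card E4 \<le> m"
  proof -
    have "card E4 \<le> (\<Sum>v\<in>B - S. card (insert v ` open_link B G v))"
      unfolding E4_def using finB by (intro card_UN_le) auto
    also have "\<dots> \<le> (\<Sum>v\<in>B - S. d)"
    proof (rule sum_mono)
      fix v assume "v \<in> B - S"
      then show "card (insert v ` open_link B G v) \<le> d"
        using stuck[of v] card_image_le[OF finite_open_link, of "insert v" B G v] by linarith
    qed
    also have "\<dots> = card (B - S) * d" by simp
    also have "\<dots> \<le> N * d"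
      unfolding N_def using B A_sub finite_V by (intro mult_right_mono card_mono) auto
    finally show ?thesis using Nd_le by linarith
  qed
  have "edges_in H B \<subseteq> E1 \<union> E2 \<union> E3 \<union> E4"
  proof
    fix h assume h: "h \<in> edges_in H B"
    then have hH: "h \<in> H" "h \<subseteq> B" "h \<in> edges_in H A" using B by (auto simp: edges_in_def)
    show "h \<in> E1 \<union> E2 \<union> E3 \<union> E4"
    proof (rule ccontr)
      assume n: "h \<notin> E1 \<union> E2 \<union> E3 \<union> E4"
      have "h \<noteq> {}" using edge_card[OF hH(1)] by auto
      \<comment> \<open>Any vertex of \<open>h\<close> will do: deleting it leaves a pair that none
        of the first three classes rules out.\<close>
      then obtain v where v: "v \<in> h" by auto
      have "h \<inter> S = {}" "h \<inter> T = {}" using n hH by (auto simp: E1_def E2_def)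
      moreover have "h - {v} \<notin> G" using n hH by (auto simp: E3_def)
      ultimately have "h - {v} \<in> open_link B G v" "v \<in> B - S"
        using v h hH B by (auto simp: open_link_def T_def insert_absorb)
      moreover have "h = insert v (h - {v})" using v by auto
      ultimately have "h \<in> E4" unfolding E4_def by blast
      then show False using n by simp
    qed
  qed
  moreover have "finite (E1 \<union> E2 \<union> E3 \<union> E4)"
    using finite_edges_in finG finite_H finB finite_open_link
    by (auto simp: E1_def E2_def E3_def E4_def)
  ultimately have "card (edges_in H B) \<le> card (E1 \<union> E2 \<union> E3 \<union> E4)" by (rule card_mono[rotated])
  also have "\<dots> \<le> card E1 + card E2 + card E3 + card E4"
    using card_Un_le[of E1 E2] card_Un_le[of "E1 \<union> E2" E3] card_Un_le[of "E1 \<union> E2 \<union> E3" E4]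
    by linarith
  finally show ?thesis using b1 b2 b3 b4 by linarith
qed

text \<open>The threshold \<open>D\<close> is about a quarter of q d/N, so a container
  \<open>C\<close> holds at most a quarter of the pairs of \<open>G\<close>. All other pairs meet
  \<open>A - C\<close>, and the degree cap turns this loss of pairs into a loss of
  hyperedges.\<close>

lemma containers_of_full_graph:
  assumes G: "link_graph S G" and S: "card S = q"
  shows "\<exists>\<D>. finite \<D> \<and> card \<D> \<le> (N + 1) ^ p \<and>
    (\<forall>C\<in>\<D>. C \<subseteq> A \<and> 192 * card (edges_in H C) \<le> 191 * m) \<and>
    (\<forall>I. S \<subseteq> I \<longrightarrow> I \<subseteq> A \<longrightarrow> independent H I \<longrightarrow> (\<exists>C\<in>\<D>. I \<subseteq> C))"
proof -
  have finG: "finite G" by (rule finite_graph[OF G])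
  have cG: "card G = q * d" using G S by (simp add: link_graph_def)
  have G2: "g \<subseteq> A" "card g = 2" if "g \<in> G" for g using G that by (auto simp: link_graph_def)
  have qd: "q\<^sup>2 * K \<le> q * d" using d_ge by (simp add: power2_eq_square)
  have NK: "4 * N * K \<le> q * d"
    using qd mult_right_mono[OF q_ge, of K] by linarith
  have "4 * N * 1 \<le> 4 * N * K" using K_pos by (intro mult_left_mono) auto
  then have N4: "4 * N \<le> q * d" using NK by linarith
  define D where "D = q * d div (4 * N)"
  have D_pos: "D \<ge> 1"
    using N4 N_pos unfolding D_def by (simp add: Suc_le_eq div_greater_zero_iff)
  have ND: "4 * N * D \<le> q * d" by (simp add: D_def)
  have "q * d < 4 * N * (D + 1)"
    unfolding D_def using N_pos dividend_less_times_div[of "4 * N" "q * d"] by (simp add: algebra_simps)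
  also have "\<dots> \<le> 4 * N * (2 * D)" using D_pos by (intro mult_left_mono) auto
  finally have qdD: "q * d \<le> 8 * N * D" by simp
  have "q\<^sup>2 * 1 \<le> q\<^sup>2 * K" using K_pos by (intro mult_left_mono) auto
  then have "q\<^sup>2 \<le> 8 * N * D" using qd qdD by linarith
  then have "p * q\<^sup>2 \<le> p * (8 * N * D)" by (rule mult_left_mono) simp
  with p_ge have "8 * N\<^sup>2 \<le> p * (8 * N * D)" by (rule order_trans)
  also have "p * (8 * N * D) = (8 * N) * (p * D)" by (simp only: mult_ac)
  also have "8 * N\<^sup>2 = (8 * N) * N" by (simp only: power2_eq_square mult_ac)
  \<comment> \<open>\<open>8 * N * D\<close> is at least the square of \<open>q\<close>, so
    \<open>p_ge\<close> makes \<open>p\<close> acceptances exhaust all vertices.\<close>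
  finally have "N \<le> p * D" using N_pos by (subst (asm) mult_le_cancel1) auto
  moreover have cA: "card A \<le> N" unfolding N_def using A_sub finite_V by (rule card_mono[rotated])
  ultimately have "card A \<le> p * D" by linarith
  then have exponent: "card A div D \<le> p"
    by (metis D_pos div_le_mono nonzero_mult_div_cancel_right not_one_le_zero)
  obtain \<D> where \<D>: "finite \<D>" "card \<D> \<le> (card A + 1) ^ (card A div D)"
    "\<forall>C\<in>\<D>. C \<subseteq> A \<and> (\<forall>v\<in>C. card {w \<in> C. {v, w} \<in> G} < D)"
    "\<forall>I. I \<subseteq> A \<longrightarrow> independent G I \<longrightarrow> (\<exists>C\<in>\<D>. I \<subseteq> C)"
    using graph_containers[OF finite_A D_pos, of G] by blast
  have "(card A + 1) ^ (card A div D) \<le> (N + 1) ^ (card A div D)"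
    using cA by (intro power_mono) auto
  also have "\<dots> \<le> (N + 1) ^ p" using exponent by (intro power_increasing) auto
  finally have card: "card \<D> \<le> (N + 1) ^ p" using \<D>(2) by linarith
  have few: "192 * card (edges_in H C) \<le> 191 * m" if "C \<in> \<D>" for C
  proof -
    have C: "C \<subseteq> A" "\<And>v. v \<in> C \<Longrightarrow> card {w \<in> C. {v, w} \<in> G} \<le> D"
      using \<D>(3) that by (auto intro: less_imp_le)
    have finC: "finite C" using C(1) finite_A finite_subset by blast
    have "card (edges_in G C) \<le> card C * D"
      using finC G2(2) C(2) by (rule card_edges_in_le_of_degree)
    moreover have "card C \<le> N" using card_mono[OF finite_A C(1)] cA by linarith
    ultimately have e1: "card (edges_in G C) \<le> N * D"
      using mult_right_mono[of "card C" N D] by linarith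
    define R where "R = A - C"
    have finR: "finite R" using finite_A by (simp add: R_def)
    have cR: "card R \<le> N"
      using card_mono[OF finite_A, of R] cA by (auto simp: R_def)
    define X where "X = {h \<in> edges_in H A. \<not> h \<subseteq> C}"
    have mX: "m = card (edges_in H C) + card X"
    proof -
      have "edges_in H A = edges_in H C \<union> X" using C(1) by (auto simp: X_def edges_in_def)
      moreover have "edges_in H C \<inter> X = {}" by (auto simp: X_def edges_in_def)
      moreover have "finite X" using finite_edges_in by (simp add: X_def)
      ultimately show ?thesis
        unfolding m_def using finite_edges_in by (metis card_Un_disjoint)
    qed
    have "(\<Sum>u\<in>R. deg u) = (\<Sum>h\<in>edges_in H A. card (h \<inter> R))"
      unfolding deg_def by (rule sum_card_incident[OF finite_edges_in finR])
    \<comment> \<open>Hyperedges inside \<open>C\<close> avoid \<open>R\<close>, so only those in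
      \<open>X\<close> contribute, each at most 3.\<close>
    also have "\<dots> = (\<Sum>h\<in>X. card (h \<inter> R))"
      by (intro sum.mono_neutral_right)
        (auto simp: X_def finite_edges_in R_def Diff_eq intro!: card_eq_0_iff[THEN iffD2])
    also have "\<dots> \<le> (\<Sum>h\<in>X. 3)"
    proof (rule sum_mono)
      fix h assume "h \<in> X"
      then have "card h = 3" by (auto simp: X_def edges_in_def edge_card)
      then show "card (h \<inter> R) \<le> 3"
        by (metis card.infinite card_mono inf_le1 zero_neq_numeral)
    qed
    finally have degR: "(\<Sum>u\<in>R. deg u) \<le> 3 * card X" by simp
    have "G \<subseteq> edges_in G C \<union> (\<Union>u\<in>R. incident G u)"
      using G2(1) by (auto simp: edges_in_def R_def incident_def)
    moreover have "finite (edges_in G C \<union> (\<Union>u\<in>R. incident G u))"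
      using finG finR by (simp add: edges_in_def incident_def)
    ultimately have "card G \<le> card (edges_in G C \<union> (\<Union>u\<in>R. incident G u))"
      by (rule card_mono[rotated])
    also have "\<dots> \<le> card (edges_in G C) + card (\<Union>u\<in>R. incident G u)"
      by (rule card_Un_le)
    also have "\<dots> \<le> N * D + (\<Sum>u\<in>R. card (incident G u))"
      using e1 card_UN_le[OF finR, of "incident G"] by linarith
    finally have "N * (q * d) \<le> N * (N * D + (\<Sum>u\<in>R. card (incident G u)))"
      using cG by simp
    also have "\<dots> = N * (N * D) + (\<Sum>u\<in>R. N * card (incident G u))"
      by (simp add: distrib_left sum_distrib_left)
    also have "(\<Sum>u\<in>R. N * card (incident G u)) \<le> (\<Sum>u\<in>R. 4 * q * deg u + N * K)"
      using G by (intro sum_mono) (simp add: link_graph_def)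
    also have "\<dots> = 4 * q * (\<Sum>u\<in>R. deg u) + card R * (N * K)"
      by (simp add: sum.distrib sum_distrib_left)
    also have "\<dots> \<le> 4 * q * (3 * card X) + N * (N * K)"
      using degR cR by (intro add_mono mult_left_mono mult_right_mono) auto
    finally have "N * (q * d) \<le> N * (N * D) + 12 * (q * card X) + N * (N * K)"
      by (simp add: mult_ac)
    moreover have "4 * (N * (N * D)) \<le> N * (q * d)" "4 * (N * (N * K)) \<le> N * (q * d)"
      using mult_le_mono2[OF ND, of N] mult_le_mono2[OF NK, of N] by (simp_all only: mult_ac)
    \<comment> \<open>The pairs inside \<open>C\<close> and the summed slack account for at most a
      quarter of \<open>N * (q * d)\<close> each. The remaining half gives
      \<open>N * d \<le> 24 * card X\<close>, and with \<open>m \<le> 8 * N * d\<close> at least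
      m/192 hyperedges are lost.\<close>
    ultimately have "N * (q * d) \<le> 24 * (q * card X)" by linarith
    then have "q * (N * d) \<le> q * (24 * card X)" by (simp only: mult_ac)
    then have "N * d \<le> 24 * card X" using q_pos by (subst (asm) mult_le_cancel1) auto
    then show ?thesis using m_le mX by linarith
  qed
  have cov: "\<exists>C\<in>\<D>. I \<subseteq> C" if I: "S \<subseteq> I" "I \<subseteq> A" "independent H I" for I
  proof -
    have "independent G I"
      unfolding independent_def
    proof (intro ballI notI)
      fix g assume "g \<in> G" "g \<subseteq> I"
      moreover from \<open>g \<in> G\<close> obtain v where "v \<in> S" "insert v g \<in> H"
        using G by (auto simp: link_graph_def)
      ultimately have "insert v g \<subseteq> I" using I(1) by auto
      with \<open>insert v g \<in> H\<close> show False using I(3) unfolding independent_def by blast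
    qed
    then show ?thesis using \<D>(4)[rule_format, OF I(2)] by simp
  qed
  have "\<forall>C\<in>\<D>. C \<subseteq> A \<and> 192 * card (edges_in H C) \<le> 191 * m" using \<D>(3) few by auto
  then show ?thesis using \<D>(1) card cov by (intro exI[of _ \<D>]) simp
qed

text \<open>The decision tree: \<open>S\<close> holds the members of \<open>I\<close> found so far
  and \<open>B\<close> the vertices not rejected, so \<open>B - S\<close> is undecided. Each query
  settles one vertex of \<open>B - S\<close>, and at most \<open>q - card S\<close> more are
  accepted; this gives the first factor. The second counts the containers at a leaf with
  \<open>q\<close> accepted vertices, while a stuck leaf contributes only \<open>B\<close>.\<close>

lemma containers_of_state:
  assumes "link_graph S G" "card S \<le> q" "B \<subseteq> A" "S \<subseteq> B"
  shows "\<exists>\<D>. finite \<D> \<and> card \<D> \<le> (card (B - S) + 1) ^ (q - card S) * (N + 1) ^ p \<and>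
    (\<forall>C\<in>\<D>. C \<subseteq> A \<and> 192 * card (edges_in H C) \<le> 191 * m) \<and>
    (\<forall>I. S \<subseteq> I \<longrightarrow> I \<subseteq> B \<longrightarrow> independent H I \<longrightarrow> (\<exists>C\<in>\<D>. I \<subseteq> C))"
  using assms
proof (induction "card (B - S)" arbitrary: B S G rule: less_induct)
  case less
  have finB: "finite B" and finS: "finite S"
    using less.prems finite_A by (auto intro: finite_subset)
  consider (full) "card S = q"
    | (stuck) "card S < q" "\<forall>v\<in>B - S. card (open_link B G v) < d"
    | (branch) v where "card S < q" "v \<in> B - S" "d \<le> card (open_link B G v)"
    using less.prems(2) by (meson le_neq_implies_less not_le)
  then show ?case
  proof cases
    case full
    obtain \<D> where \<D>: "finite \<D>" "card \<D> \<le> (N + 1) ^ p"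
      "\<forall>C\<in>\<D>. C \<subseteq> A \<and> 192 * card (edges_in H C) \<le> 191 * m"
      "\<forall>I. S \<subseteq> I \<longrightarrow> I \<subseteq> A \<longrightarrow> independent H I \<longrightarrow> (\<exists>C\<in>\<D>. I \<subseteq> C)"
      using containers_of_full_graph[OF less.prems(1) full] by auto
    have "\<exists>C\<in>\<D>. I \<subseteq> C" if "S \<subseteq> I" "I \<subseteq> B" "independent H I" for I
      using \<D>(4) that less.prems(3) by blast
    moreover have "card \<D> \<le> (card (B - S) + 1) ^ (q - card S) * (N + 1) ^ p"
      using \<D>(2) full by simp
    ultimately show ?thesis using \<D>(1,3) by blast
  next
    case stuck
    have "192 * card (edges_in H B) \<le> 191 * m"
      by (rule edges_le_of_stuck[OF less.prems(1,2,3)]) (use stuck in auto)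
    then show ?thesis using less.prems(3)
      by (intro exI[of _ "{B}"]) (auto simp: Suc_le_eq)
  next
    case branch
    obtain L where L: "L \<subseteq> open_link B G v" "card L = d"
      using obtain_subset_with_card_n[OF branch(3)] by metis
    define a k where "a = card (B - S)" and "k = q - card S"
    have a1: "a \<ge> 1" using branch(2) finB by (auto simp: a_def Suc_le_eq card_gt_0_iff)
    have k1: "k \<ge> 1" using branch(1) by (simp add: k_def)
    \<comment> \<open>Both answers leave the same undecided set; they differ only in the budget
      \<open>k\<close>.\<close>
    have e1: "B - {v} - S = B - S - {v}" "B - insert v S = B - S - {v}" by auto
    have c: "card (B - S - {v}) = a - 1" using branch(2) finB by (simp add: a_def)
    have less1: "card (B - {v} - S) < card (B - S)" "card (B - insert v S) < card (B - S)"
      unfolding e1 c using a1 by (auto simp: a_def)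
    have cS: "card (insert v S) = card S + 1" using branch(2) finS by simp
    have G': "link_graph (insert v S) (G \<union> L)"
      using link_graph_extend[OF less.prems(1,3) _ _ L] branch(2) by blast
    have B': "B - {v} \<subseteq> A" "S \<subseteq> B - {v}" using less.prems(3,4) branch(2) by auto
    obtain \<D>1 where D1: "finite \<D>1" "card \<D>1 \<le> a ^ k * (N + 1) ^ p"
      "\<forall>C\<in>\<D>1. C \<subseteq> A \<and> 192 * card (edges_in H C) \<le> 191 * m"
      "\<forall>I. S \<subseteq> I \<longrightarrow> I \<subseteq> B - {v} \<longrightarrow> independent H I \<longrightarrow> (\<exists>C\<in>\<D>1. I \<subseteq> C)"
      using less.hyps[OF less1(1) less.prems(1,2) B'] a1
      unfolding e1 c k_def by auto
    have "card (insert v S) \<le> q" "insert v S \<subseteq> B" using cS branch less.prems(4) by auto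
    then obtain \<D>2 where D2: "finite \<D>2" "card \<D>2 \<le> a ^ (k - 1) * (N + 1) ^ p"
      "\<forall>C\<in>\<D>2. C \<subseteq> A \<and> 192 * card (edges_in H C) \<le> 191 * m"
      "\<forall>I. insert v S \<subseteq> I \<longrightarrow> I \<subseteq> B \<longrightarrow> independent H I \<longrightarrow> (\<exists>C\<in>\<D>2. I \<subseteq> C)"
      using less.hyps[OF less1(2) G' _ less.prems(3)] a1
      unfolding e1 c k_def cS by (auto simp: algebra_simps)
    have "card (\<D>1 \<union> \<D>2) \<le> (a ^ k + a ^ (k - 1)) * (N + 1) ^ p"
      using card_Un_le[of \<D>1 \<D>2] D1(2) D2(2) unfolding distrib_right by linarith
    also have "\<dots> \<le> (a + 1) ^ k * (N + 1) ^ p"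
      using power_add_power_pred_le[OF k1] by (rule mult_right_mono) simp
    finally have card: "card (\<D>1 \<union> \<D>2) \<le> (a + 1) ^ k * (N + 1) ^ p" .
    have cov: "\<exists>C\<in>\<D>1 \<union> \<D>2. I \<subseteq> C" if I: "S \<subseteq> I" "I \<subseteq> B" "independent H I" for I
    proof (cases "v \<in> I")
      case True
      then have "insert v S \<subseteq> I" using I by auto
      then obtain C where "C \<in> \<D>2" "I \<subseteq> C" using D2(4)[rule_format, of I] I by auto
      then show ?thesis by blast
    next
      case False
      then have "I \<subseteq> B - {v}" using I by auto
      then obtain C where "C \<in> \<D>1" "I \<subseteq> C" using D1(4)[rule_format, of I] I by auto
      then show ?thesis by blast
    qed
    have "finite (\<D>1 \<union> \<D>2)" using D1(1) D2(1) by simp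
    moreover have "\<forall>C\<in>\<D>1 \<union> \<D>2. C \<subseteq> A \<and> 192 * card (edges_in H C) \<le> 191 * m"
      using D1(3) D2(3) by blast
    ultimately show ?thesis
      using card cov unfolding a_def k_def by blast
  qed
qed

lemma containers_step:
  "\<exists>\<D>. finite \<D> \<and> card \<D> \<le> (N + 1) ^ (q + p) \<and>
    (\<forall>C\<in>\<D>. C \<subseteq> A \<and> 192 * card (edges_in H C) \<le> 191 * m) \<and>
    (\<forall>I. I \<subseteq> A \<longrightarrow> independent H I \<longrightarrow> (\<exists>C\<in>\<D>. I \<subseteq> C))"
proof -
  have "link_graph {} {}" by (simp add: link_graph_def incident_def)
  then obtain \<D> where \<D>: "finite \<D>" "card \<D> \<le> (card A + 1) ^ q * (N + 1) ^ p"
    "\<forall>C\<in>\<D>. C \<subseteq> A \<and> 192 * card (edges_in H C) \<le> 191 * m"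
    "\<forall>I. I \<subseteq> A \<longrightarrow> independent H I \<longrightarrow> (\<exists>C\<in>\<D>. I \<subseteq> C)"
    using containers_of_state[of "{}" "{}" A] by auto
  have "card A \<le> N" unfolding N_def using A_sub finite_V by (rule card_mono[rotated])
  then have "(card A + 1) ^ q * (N + 1) ^ p \<le> (N + 1) ^ q * (N + 1) ^ p"
    by (intro mult_right_mono power_mono) auto
  then have "card \<D> \<le> (N + 1) ^ (q + p)"
    unfolding power_add using \<D>(2) by linarith
  then show ?thesis using \<D>(1,3,4) by blast
qed

end

section \<open>Iterating the container step\<close>

context bounded_codegree
begin

text \<open>Among the numerical requirements of the step only \<open>m_ge\<close> involves the
  current set, so the same \<open>q\<close> and \<open>p\<close> serve in every round. A set at or
  below that threshold is kept as its own container, whence the disjunction in the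
  conclusion.\<close>

lemma containers_iterated:
  fixes q p t :: nat
  assumes "K \<ge> 1" "q \<ge> 1" "2 * K * q \<le> card V" "4 * card V \<le> q\<^sup>2"
    and "8 * (card V)\<^sup>2 \<le> p * q\<^sup>2"
  shows "\<exists>\<D>. finite \<D> \<and> card \<D> \<le> ((card V + 1) ^ (q + p)) ^ t \<and>
    (\<forall>C\<in>\<D>. C \<subseteq> V \<and> (card (edges_in H C) \<le> 4 * q * K * card V \<or>
      192 ^ t * card (edges_in H C) \<le> 191 ^ t * card H)) \<and>
    (\<forall>I. I \<subseteq> V \<longrightarrow> independent H I \<longrightarrow> (\<exists>C\<in>\<D>. I \<subseteq> C))"
proof (induction t)
  case 0
  have "edges_in H V = H" using edge_sub by (auto simp: edges_in_def)
  then show ?case by (intro exI[of _ "{V}"]) auto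
next
  case (Suc t)
  define b where "b = (card V + 1) ^ (q + p)"
  have b1: "1 \<le> b" by (simp add: b_def)
  obtain \<D> where \<D>: "finite \<D>" "card \<D> \<le> b ^ t"
    "\<And>C. C \<in> \<D> \<Longrightarrow> C \<subseteq> V"
    "\<And>C. C \<in> \<D> \<Longrightarrow> card (edges_in H C) \<le> 4 * q * K * card V \<or>
      192 ^ t * card (edges_in H C) \<le> 191 ^ t * card H"
    "\<And>I. I \<subseteq> V \<Longrightarrow> independent H I \<Longrightarrow> (\<exists>C\<in>\<D>. I \<subseteq> C)"
    using Suc unfolding b_def[symmetric] by auto
  define Q where "Q C \<E> \<longleftrightarrow> finite \<E> \<and> card \<E> \<le> b \<and>
      (\<forall>C'\<in>\<E>. C' \<subseteq> C \<and> (card (edges_in H C') \<le> 4 * q * K * card V \<or>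
        192 * card (edges_in H C') \<le> 191 * card (edges_in H C))) \<and>
      (\<forall>I. I \<subseteq> C \<longrightarrow> independent H I \<longrightarrow> (\<exists>C'\<in>\<E>. I \<subseteq> C'))" for C \<E>
  have "\<exists>\<E>. Q C \<E>" if C: "C \<in> \<D>" for C
  proof (cases "card (edges_in H C) \<le> 4 * q * K * card V")
    case True
    then have "Q C {C}" using b1 by (simp add: Q_def)
    then show ?thesis ..
  next
    case False
    interpret container_step V H K C q p "card (edges_in H C) div (4 * card V)" "card V"
      "card (edges_in H C)"
      by unfold_locales (use assms \<D>(3)[OF C] False in auto)
    obtain \<E> where "finite \<E>" "card \<E> \<le> b"
      "\<forall>C'\<in>\<E>. C' \<subseteq> C \<and> 192 * card (edges_in H C') \<le> 191 * card (edges_in H C)"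
      "\<forall>I. I \<subseteq> C \<longrightarrow> independent H I \<longrightarrow> (\<exists>C'\<in>\<E>. I \<subseteq> C')"
      using containers_step[folded b_def] by (elim exE conjE) (rule that)
    then have "Q C \<E>" unfolding Q_def by simp
    then show ?thesis ..
  qed
  then obtain f where "\<And>C. C \<in> \<D> \<Longrightarrow> Q C (f C)" by metis
  then have f: "\<And>C. C \<in> \<D> \<Longrightarrow> finite (f C)"
    "\<And>C. C \<in> \<D> \<Longrightarrow> card (f C) \<le> b"
    "\<And>C C'. C \<in> \<D> \<Longrightarrow> C' \<in> f C \<Longrightarrow> C' \<subseteq> C"
    "\<And>C C'. C \<in> \<D> \<Longrightarrow> C' \<in> f C \<Longrightarrow> card (edges_in H C') \<le> 4 * q * K * card V \<or>
        192 * card (edges_in H C') \<le> 191 * card (edges_in H C)"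
    "\<And>C I. C \<in> \<D> \<Longrightarrow> I \<subseteq> C \<Longrightarrow> independent H I \<Longrightarrow> (\<exists>C'\<in>f C. I \<subseteq> C')"
    unfolding Q_def by blast+
  define \<F> where "\<F> = (\<Union>C\<in>\<D>. f C)"
  have "card \<F> \<le> (\<Sum>C\<in>\<D>. card (f C))" unfolding \<F>_def by (rule card_UN_le[OF \<D>(1)])
  also have "\<dots> \<le> (\<Sum>C\<in>\<D>. b)" using f(2) by (rule sum_mono)
  also have "\<dots> \<le> b ^ t * b" using \<D>(2) by simp
  finally have "card \<F> \<le> b ^ Suc t" by (simp add: mult.commute)
  moreover have "finite \<F>" using \<D>(1) f(1) by (simp add: \<F>_def)
  moreover have "C' \<subseteq> V \<and> (card (edges_in H C') \<le> 4 * q * K * card V \<or>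
      192 ^ Suc t * card (edges_in H C') \<le> 191 ^ Suc t * card H)" if mem: "C' \<in> \<F>" for C'
  proof -
    obtain C where C: "C \<in> \<D>" "C' \<in> f C" using mem by (auto simp: \<F>_def)
    have sub: "C' \<subseteq> C" "C \<subseteq> V" using f(3) \<D>(3) C by auto
    \<comment> \<open>A subset of a sparse set is sparse, so a child above the threshold has a
      parent above it, and the two decay bounds can be chained.\<close>
    have le: "card (edges_in H C') \<le> card (edges_in H C)"
      using sub(1) finite_H by (intro card_mono) (auto simp: edges_in_def)
    show ?thesis
    proof (cases "card (edges_in H C') \<le> 4 * q * K * card V")
      case False
      then have 1: "192 * card (edges_in H C') \<le> 191 * card (edges_in H C)"
        and 2: "192 ^ t * card (edges_in H C) \<le> 191 ^ t * card H"
        using f(4)[OF C] \<D>(4)[OF C(1)] le by auto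
      have "192 ^ t * (192 * card (edges_in H C')) \<le> 192 ^ t * (191 * card (edges_in H C))"
        using 1 by (rule mult_left_mono) simp
      also have "\<dots> = 191 * (192 ^ t * card (edges_in H C))" by (simp only: mult_ac)
      also have "\<dots> \<le> 191 * (191 ^ t * card H)" using 2 by (rule mult_left_mono) simp
      finally show ?thesis using sub by (simp add: mult_ac)
    qed (use sub in auto)
  qed
  moreover have "\<exists>C'\<in>\<F>. I \<subseteq> C'" if I: "I \<subseteq> V" "independent H I" for I
  proof -
    obtain C where C: "C \<in> \<D>" "I \<subseteq> C" using \<D>(5)[OF I] by auto
    obtain C' where "C' \<in> f C" "I \<subseteq> C'" using f(5)[OF C I(2)] by auto
    then show ?thesis using C(1) unfolding \<F>_def by auto
  qed
  ultimately show ?case unfolding b_def by (intro exI[of _ \<F>]) simp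
qed

text \<open>Each block of 192 rounds at least halves the decay bound, and
  \<open>card H < 2 ^ j\<close> by \<open>card_H_le\<close>. After \<open>192 * j\<close> rounds the
  second alternative of \<open>containers_iterated\<close> thus leaves no hyperedge, and every
  container is below the threshold.\<close>

lemma containers:
  fixes q p j :: nat
  assumes "K \<ge> 1" "q \<ge> 1" "2 * K * q \<le> card V" "4 * card V \<le> q\<^sup>2"
    and "8 * (card V)\<^sup>2 \<le> p * q\<^sup>2" and "K * (card V)\<^sup>2 < 2 ^ j"
  shows "\<exists>\<D>. finite \<D> \<and> card \<D> \<le> (card V + 1) ^ ((q + p) * (192 * j)) \<and>
    (\<forall>C\<in>\<D>. C \<subseteq> V \<and> card (edges_in H C) \<le> 4 * q * K * card V) \<and>
    (\<forall>I. I \<subseteq> V \<longrightarrow> independent H I \<longrightarrow> (\<exists>C\<in>\<D>. I \<subseteq> C))"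
proof -
  obtain \<D> where \<D>: "finite \<D>" "card \<D> \<le> ((card V + 1) ^ (q + p)) ^ (192 * j)"
    "\<forall>C\<in>\<D>. C \<subseteq> V \<and> (card (edges_in H C) \<le> 4 * q * K * card V \<or>
      192 ^ (192 * j) * card (edges_in H C) \<le> 191 ^ (192 * j) * card H)"
    "\<forall>I. I \<subseteq> V \<longrightarrow> independent H I \<longrightarrow> (\<exists>C\<in>\<D>. I \<subseteq> C)"
    using containers_iterated[OF assms(1-5), of "192 * j"] by blast
  have "edges_in H C = {}" if "192 ^ (192 * j) * card (edges_in H C) \<le> 191 ^ (192 * j) * card H" for C
  proof (rule ccontr)
    assume "edges_in H C \<noteq> {}"
    then have c: "1 \<le> card (edges_in H C)"
      using finite_H by (simp add: edges_in_def Suc_le_eq card_gt_0_iff)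
    \<comment> \<open>That is, (1 - 1/192)^192 is at most 1/2; it is in fact below 1/e.\<close>
    have "real (2 * 191 ^ 192) \<le> real (192 ^ 192)" by simp
    then have "2 * 191 ^ 192 \<le> (192 ^ 192 :: nat)" by (simp only: of_nat_le_iff)
    then have "(2 * 191 ^ 192) ^ j \<le> (192 ^ 192 :: nat) ^ j" by (rule power_mono) simp
    then have "2 ^ j * 191 ^ (192 * j) \<le> (192 ^ (192 * j) :: nat)"
      by (simp only: power_mult_distrib power_mult)
    also have "\<dots> * 1 \<le> 192 ^ (192 * j) * card (edges_in H C)"
      using c by (rule mult_left_mono) simp
    finally have "2 ^ j * 191 ^ (192 * j) \<le> (191 :: nat) ^ (192 * j) * card H"
      using that by linarith
    then have "(191 :: nat) ^ (192 * j) * 2 ^ j \<le> 191 ^ (192 * j) * card H"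
      by (simp only: mult.commute)
    then have "2 ^ j \<le> card H" by (subst (asm) mult_le_cancel1) auto
    then show False using assms(6) card_H_le by simp
  qed
  then have "card (edges_in H C) \<le> 4 * q * K * card V" if "C \<in> \<D>" for C
    using \<D>(3) that by (metis card.empty le0)
  then show ?thesis using \<D>
    unfolding power_mult[symmetric] by blast
qed

end

section \<open>The hypergraph of rainbow sums\<close>

definition rainbow_sums :: "nat \<Rightarrow> nat \<Rightarrow> ((nat \<times> nat \<times> nat) \<times> (nat \<times> nat \<times> nat)) set" where
  "rainbow_sums r n = {((a, b, c), (\<alpha>, \<beta>, \<gamma>)).
     (a, b, c) \<in> restricted_schur_triples {1..n} \<and>
     \<alpha> \<in> {1..r} \<and> \<beta> \<in> {1..r} \<and> \<gamma> \<in> {1..r} \<and> \<alpha> \<noteq> \<beta> \<and> \<beta> \<noteq> \<gamma> \<and> \<alpha> \<noteq> \<gamma>}"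

fun coloured_triple :: "(nat \<times> nat \<times> nat) \<times> (nat \<times> nat \<times> nat) \<Rightarrow> (nat \<times> nat) set" where
  "coloured_triple ((a, b, c), (\<alpha>, \<beta>, \<gamma>)) = {(a, \<alpha>), (b, \<beta>), (c, \<gamma>)}"

definition sum_hypergraph :: "nat \<Rightarrow> nat \<Rightarrow> (nat \<times> nat) set set" where
  "sum_hypergraph r n = coloured_triple ` rainbow_sums r n"

text \<open>A template amounts to a set of vertices (x, \<alpha>) of the hypergraph, with
  subtemplates as subsets. Restricting to [n] makes the function extensional, as
  \<open>templates\<close> demands.\<close>

definition template_of :: "nat \<Rightarrow> (nat \<times> nat) set \<Rightarrow> nat \<Rightarrow> nat set" where
  "template_of n C = (\<lambda>x\<in>{1..n}. {\<alpha>. (x, \<alpha>) \<in> C})"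

text \<open>Hyperedges are sets, whereas \<open>RS\<close> counts ordered data. Nothing is lost: the
  minimum and maximum of the first coordinates identify \<open>a\<close> and \<open>c\<close>, hence
  \<open>b\<close>, and distinct first coordinates then fix the colours.\<close>

lemma coloured_triple_eq_imp:
  fixes a b c a' b' c' :: nat
  assumes "{(a, \<alpha>), (b, \<beta>), (c, \<gamma>)} = {(a', \<alpha>'), (b', \<beta>'), (c', \<gamma>')}"
    and "a < b" "b < c" "a' < b'" "b' < c'"
  shows "a = a' \<and> b = b' \<and> c = c' \<and> \<alpha> = \<alpha>' \<and> \<beta> = \<beta>' \<and> \<gamma> = \<gamma>'"
proof -
  have "fst ` {(a, \<alpha>), (b, \<beta>), (c, \<gamma>)} = fst ` {(a', \<alpha>'), (b', \<beta>'), (c', \<gamma>')}"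
    using assms(1) by (rule arg_cong)
  then have eq: "{a, b, c} = {a', b', c'}" by simp
  have "a = Min {a, b, c}" "c = Max {a, b, c}" "a' = Min {a', b', c'}" "c' = Max {a', b', c'}"
    using assms(2-) by auto
  with eq have ac: "a = a'" "c = c'" by metis+
  have b: "b = b'"
  proof -
    have "b \<in> {a', b', c'}" using eq by blast
    then show ?thesis using assms(2-) ac by auto
  qed
  have "(a, \<alpha>) \<in> {(a', \<alpha>'), (b', \<beta>'), (c', \<gamma>')}" "(b, \<beta>) \<in> {(a', \<alpha>'), (b', \<beta>'), (c', \<gamma>')}"
    "(c, \<gamma>) \<in> {(a', \<alpha>'), (b', \<beta>'), (c', \<gamma>')}"
    unfolding assms(1)[symmetric] by simp_all
  then show ?thesis using assms(2-) ac b by auto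
qed

lemma inj_on_coloured_triple: "inj_on coloured_triple (rainbow_sums r n)"
proof (rule inj_onI)
  fix x y assume x: "x \<in> rainbow_sums r n" and y: "y \<in> rainbow_sums r n"
    and eq: "coloured_triple x = coloured_triple y"
  obtain a b c \<alpha> \<beta> \<gamma> where xx: "x = ((a, b, c), (\<alpha>, \<beta>, \<gamma>))" by (metis prod.collapse)
  obtain a' b' c' \<alpha>' \<beta>' \<gamma>' where yy: "y = ((a', b', c'), (\<alpha>', \<beta>', \<gamma>'))" by (metis prod.collapse)
  have "a < b" "b < c" "a' < b'" "b' < c'"
    using x y by (auto simp: xx yy rainbow_sums_def restricted_schur_triples_def)
  from coloured_triple_eq_imp[OF eq[unfolded xx yy coloured_triple.simps] this] show "x = y"
    by (simp add: xx yy)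
qed

lemma RS_template_of:
  assumes "C \<subseteq> {1..n} \<times> {1..r}"
  shows "RS n (template_of n C) = card (edges_in (sum_hypergraph r n) C)"
proof -
  have set_eq: "{((a, b, c), (\<alpha>, \<beta>, \<gamma>)). (a, b, c) \<in> restricted_schur_triples {1..n} \<and>
     \<alpha> \<in> template_of n C a \<and> \<beta> \<in> template_of n C b \<and> \<gamma> \<in> template_of n C c \<and>
     \<alpha> \<noteq> \<beta> \<and> \<beta> \<noteq> \<gamma> \<and> \<alpha> \<noteq> \<gamma>} = {t \<in> rainbow_sums r n. coloured_triple t \<subseteq> C}"
    using assms by (auto simp: rainbow_sums_def template_of_def restricted_schur_triples_def)
  have "edges_in (sum_hypergraph r n) C = coloured_triple ` {t \<in> rainbow_sums r n. coloured_triple t \<subseteq> C}"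
    by (auto simp: edges_in_def sum_hypergraph_def)
  moreover have "inj_on coloured_triple {t \<in> rainbow_sums r n. coloured_triple t \<subseteq> C}"
    by (rule inj_on_subset[OF inj_on_coloured_triple]) auto
  ultimately show ?thesis
    unfolding RS_def set_eq by (simp add: card_image)
qed

section \<open>Codegrees of the sum hypergraph and transfer to templates\<close>

lemma sum_hypergraph_edgeE:
  assumes "h \<in> sum_hypergraph r n"
  obtains a b \<alpha> \<beta> \<gamma> where "h = {(a, \<alpha>), (b, \<beta>), (a + b, \<gamma>)}" "1 \<le> a" "a < b" "a + b \<le> n"
    "\<alpha> \<in> {1..r}" "\<beta> \<in> {1..r}" "\<gamma> \<in> {1..r}"
proof -
  obtain t where t: "t \<in> rainbow_sums r n" "h = coloured_triple t"
    using assms by (auto simp: sum_hypergraph_def)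
  obtain a b c \<alpha> \<beta> \<gamma> where "t = ((a, b, c), (\<alpha>, \<beta>, \<gamma>))" by (metis prod.collapse)
  note t = t[unfolded this]
  show ?thesis
    by (rule that[of a \<alpha> b \<beta> \<gamma>])
      (use t in \<open>auto simp: rainbow_sums_def restricted_schur_triples_def\<close>)
qed

text \<open>Two vertices of a hyperedge leave three choices for the number in the third, their sum
  or one of the two differences, and \<open>r\<close> choices for its colour.\<close>

lemma bounded_codegree_sum_hypergraph:
  "bounded_codegree ({1..n} \<times> {1..r}) (sum_hypergraph r n) (3 * r)"
proof
  show "finite ({1..n} \<times> {1..r})" by simp
next
  fix h assume "h \<in> sum_hypergraph r n"
  then obtain a b \<alpha> \<beta> \<gamma> where h: "h = {(a, \<alpha>), (b, \<beta>), (a + b, \<gamma>)}" "1 \<le> a" "a < b" "a + b \<le> n"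
    "\<alpha> \<in> {1..r}" "\<beta> \<in> {1..r}" "\<gamma> \<in> {1..r}"
    by (rule sum_hypergraph_edgeE)
  then show "h \<subseteq> {1..n} \<times> {1..r}" and "card h = 3" by auto
next
  fix u w :: "nat \<times> nat" assume uw: "u \<noteq> w"
  define X where "X = {fst u + fst w, fst u - fst w, fst w - fst u} \<times> {1..r}"
  have "{h \<in> sum_hypergraph r n. u \<in> h \<and> w \<in> h} \<subseteq> (\<lambda>t. {u, w, t}) ` X"
  proof
    fix h assume hh: "h \<in> {h \<in> sum_hypergraph r n. u \<in> h \<and> w \<in> h}"
    then have "h \<in> sum_hypergraph r n" by simp
    then obtain a b \<alpha> \<beta> \<gamma> where h: "h = {(a, \<alpha>), (b, \<beta>), (a + b, \<gamma>)}"
      "\<alpha> \<in> {1..r}" "\<beta> \<in> {1..r}" "\<gamma> \<in> {1..r}"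
      by (rule sum_hypergraph_edgeE)
    have "\<exists>t\<in>X. h = {u, w, t}"
    proof -
      consider "u = (a, \<alpha>)" "w = (b, \<beta>)" | "u = (b, \<beta>)" "w = (a, \<alpha>)"
        | "u = (a, \<alpha>)" "w = (a + b, \<gamma>)" | "u = (a + b, \<gamma>)" "w = (a, \<alpha>)"
        | "u = (b, \<beta>)" "w = (a + b, \<gamma>)" | "u = (a + b, \<gamma>)" "w = (b, \<beta>)"
        using hh uw h(1) by auto
      then show ?thesis
      proof cases
        case 1 then show ?thesis using h by (intro bexI[of _ "(a + b, \<gamma>)"]) (auto simp: X_def)
      next
        case 2 then show ?thesis using h by (intro bexI[of _ "(a + b, \<gamma>)"]) (auto simp: X_def)
      next
        case 3 then show ?thesis using h by (intro bexI[of _ "(b, \<beta>)"]) (auto simp: X_def)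
      next
        case 4 then show ?thesis using h by (intro bexI[of _ "(b, \<beta>)"]) (auto simp: X_def)
      next
        case 5 then show ?thesis using h by (intro bexI[of _ "(a, \<alpha>)"]) (auto simp: X_def)
      next
        case 6 then show ?thesis using h by (intro bexI[of _ "(a, \<alpha>)"]) (auto simp: X_def)
      qed
    qed
    then show "h \<in> (\<lambda>t. {u, w, t}) ` X" by blast
  qed
  moreover have "finite X" by (simp add: X_def)
  ultimately have "card {h \<in> sum_hypergraph r n. u \<in> h \<and> w \<in> h} \<le> card X"
    by (meson card_image_le card_mono finite_imageI le_trans)
  also have "card X = card {fst u + fst w, fst u - fst w, fst w - fst u} * r"
    by (simp add: X_def card_cartesian_product)
  also have "\<dots> \<le> 3 * r"
    by (intro mult_right_mono) (auto simp: card_insert_if)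
  finally show "card {h \<in> sum_hypergraph r n. u \<in> h \<and> w \<in> h} \<le> 3 * r" .
qed

text \<open>With \<open>K = 3 * r\<close> and N = nr, the hypothesis \<open>6 * q \<le> n\<close>
  gives \<open>2 * K * q \<le> N\<close>, and the bound 4qKN becomes 12 q r^2 n. A rainbow sum-free
  template is an independent set.\<close>

lemma template_containers:
  fixes r n q p j :: nat
  assumes "1 \<le> r" "1 \<le> q" "6 * q \<le> n" "4 * (n * r) \<le> q\<^sup>2"
    and "8 * (n * r)\<^sup>2 \<le> p * q\<^sup>2" and "3 * r * (n * r)\<^sup>2 < 2 ^ j"
  shows "\<exists>\<C>. \<C> \<subseteq> templates r n \<and>
    (\<forall>P\<in>templates r n. rainbow_restricted_sum_free n P \<longrightarrow> (\<exists>Q\<in>\<C>. subtemplate n P Q)) \<and>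
    (\<forall>P\<in>\<C>. RS n P \<le> 12 * q * r\<^sup>2 * n) \<and>
    card \<C> \<le> (n * r + 1) ^ ((q + p) * (192 * j))"
proof -
  define V where "V = {1..n} \<times> {1..r}"
  define H where "H = sum_hypergraph r n"
  interpret bounded_codegree V H "3 * r"
    unfolding V_def H_def by (rule bounded_codegree_sum_hypergraph)
  have cV: "card V = n * r" by (simp add: V_def card_cartesian_product)
  have "2 * (3 * r) * q \<le> n * r" using mult_right_mono[OF assms(3), of r] by (simp add: mult_ac)
  then obtain \<D> where \<D>: "finite \<D>" "card \<D> \<le> (n * r + 1) ^ ((q + p) * (192 * j))"
    "\<forall>C\<in>\<D>. C \<subseteq> V \<and> card (edges_in H C) \<le> 4 * q * (3 * r) * (n * r)"
    "\<forall>I. I \<subseteq> V \<longrightarrow> independent H I \<longrightarrow> (\<exists>C\<in>\<D>. I \<subseteq> C)"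
    using containers[of q p j] assms unfolding cV by auto
  have sub: "C \<subseteq> V" if "C \<in> \<D>" for C using \<D>(3) that by blast
  have "template_of n C \<in> templates r n" if "C \<in> \<D>" for C
    using sub[OF that] by (auto simp: template_of_def templates_def V_def)
  moreover have "RS n (template_of n C) \<le> 12 * q * r\<^sup>2 * n" if "C \<in> \<D>" for C
    using \<D>(3) that RS_template_of[of C n r] unfolding H_def V_def
    by (auto simp: power2_eq_square mult_ac)
  moreover have "card (template_of n ` \<D>) \<le> (n * r + 1) ^ ((q + p) * (192 * j))"
    using \<D>(2) card_image_le[OF \<D>(1), of "template_of n"] by linarith
  moreover have "\<exists>C\<in>\<D>. subtemplate n P (template_of n C)"
    if P: "P \<in> templates r n" "rainbow_restricted_sum_free n P" for P
  proof -
    define I where "I = {(x, \<alpha>). x \<in> {1..n} \<and> \<alpha> \<in> P x}"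
    have IV: "I \<subseteq> V" using P(1) by (auto simp: I_def V_def templates_def PiE_def Pi_def)
    \<comment> \<open>Equality as functions holds because templates are extensional: both sides are
      \<open>undefined\<close> outside [n].\<close>
    have "template_of n I = P"
      using P(1) by (auto simp: template_of_def I_def templates_def PiE_def extensional_def fun_eq_iff)
    then have "card (edges_in H I) = 0"
      using RS_template_of[of I n r] IV P(2)
      by (simp add: H_def V_def rainbow_restricted_sum_free_def)
    then have "edges_in H I = {}" using finite_H by (simp add: edges_in_def)
    then have "independent H I" by (auto simp: edges_in_def independent_def)
    then obtain C where "C \<in> \<D>" "I \<subseteq> C" using \<D>(4) IV by blast
    then show ?thesis
      by (intro bexI[of _ C]) (auto simp: subtemplate_def template_of_def I_def)
  qed
  ultimately show ?thesis by (intro exI[of _ "template_of n ` \<D>"]) auto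
qed

section \<open>Choice of parameters\<close>

text \<open>With \<open>k = n div 4\<close>, any a in [1, k] and b in [k + 1, 2k] give a triple, as
  a + b \<le> 3k \<le> n. From n < 4k + 4 and n \<ge> 8 it follows that k is at least n/8.\<close>

lemma s_ge:
  assumes "n \<ge> 8"
  shows "(real n)\<^sup>2 / 64 \<le> real (s {1..n})"
proof -
  define k where "k = n div 4"
  have k: "4 * k \<le> n" "n < 4 * k + 4" by (auto simp: k_def)
  have sub: "(\<lambda>(a, b). (a, b, a + b)) ` ({1..k} \<times> {k + 1..2 * k}) \<subseteq> restricted_schur_triples {1..n}"
    using k(1) by (auto simp: restricted_schur_triples_def)
  have "inj_on (\<lambda>(a, b). (a, b, a + b)) ({1..k} \<times> {k + 1..2 * k})"
    by (auto simp: inj_on_def)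
  then have "k * k = card ((\<lambda>(a, b). (a, b, a + b)) ` ({1..k} \<times> {k + 1..2 * k}))"
    by (simp add: card_image card_cartesian_product)
  also have "\<dots> \<le> s {1..n}"
    unfolding s_def
  proof (rule card_mono[OF _ sub])
    show "finite (restricted_schur_triples {1..n})"
      by (rule finite_subset[of _ "{1..n} \<times> {1..n} \<times> {1..n}"])
        (auto simp: restricted_schur_triples_def)
  qed
  finally have "real k * real k \<le> real (s {1..n})"
    by (metis of_nat_le_iff of_nat_mult)
  moreover have "real n / 8 \<le> real k" using k(2) assms by linarith
  then have "(real n / 8)\<^sup>2 \<le> (real k)\<^sup>2" by (rule power_mono) simp
  ultimately show ?thesis by (simp add: power2_eq_square)
qed

text \<open>For bounded \<open>n\<close> the sum-free templates can serve as their own containers: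
  there are at most 2^(rn) of them, and \<open>c\<close> is at least rn.\<close>

lemma small_order:
  fixes r n :: nat and c :: real
  assumes n: "n \<ge> 1" and c: "real r * real n \<le> c"
  shows "\<exists>\<C>. \<C> \<subseteq> templates r n \<and>
      (\<forall>P\<in>templates r n. rainbow_restricted_sum_free n P \<longrightarrow> (\<exists>Q\<in>\<C>. subtemplate n P Q)) \<and>
      (\<forall>P\<in>\<C>. real (RS n P) \<le> real n powr (- (1 / 3)) * real (s {1..n})) \<and>
      real (card \<C>) \<le> 2 powr (c * real n powr (2 / 3) * (log 2 (real n))\<^sup>2)"
proof (cases "n = 1")
  case True
  \<comment> \<open>For n = 1 the logarithm vanishes, so the collection may have only one member.
    The full template works, as there is no triple.\<close>
  define F where "F = (\<lambda>x\<in>{1..n}. {1..r})"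
  have "F \<in> templates r n" by (auto simp: F_def templates_def)
  moreover have "subtemplate n P F" if "P \<in> templates r n" for P
    using that by (auto simp: subtemplate_def F_def templates_def PiE_def Pi_def)
  moreover have "restricted_schur_triples {1..n} = {}"
    using True by (auto simp: restricted_schur_triples_def)
  then have "RS n F = 0" by (simp add: RS_def split_def)
  ultimately show ?thesis using True by (intro exI[of _ "{F}"]) auto
next
  case False
  then have n2: "real n \<ge> 2" using n by simp
  define \<C> where "\<C> = {P \<in> templates r n. rainbow_restricted_sum_free n P}"
  have fin: "finite (templates r n)" unfolding templates_def by (intro finite_PiE) auto
  have "card \<C> \<le> card (templates r n)" unfolding \<C>_def using fin by (intro card_mono) auto
  also have "\<dots> = 2 ^ (r * n)"
    unfolding templates_def by (simp add: card_PiE card_Pow power_mult)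
  finally have "real (card \<C>) \<le> real (2 ^ (r * n))" by (simp only: of_nat_le_iff)
  also have "\<dots> = 2 powr (real r * real n)" by (simp add: powr_realpow flip: of_nat_mult)
  also have "\<dots> \<le> 2 powr (c * real n powr (2 / 3) * (log 2 (real n))\<^sup>2)"
  proof (rule powr_mono)
    have 1: "1 \<le> real n powr (2 / 3)" using n2 by (simp add: ge_one_powr_ge_zero)
    have "1 \<le> log 2 (real n)" using n2 by (simp add: le_log_iff)
    then have 2: "1 \<le> (log 2 (real n))\<^sup>2" by simp
    have "1 * 1 \<le> real n powr (2 / 3) * (log 2 (real n))\<^sup>2"
      using 1 2 by (intro mult_mono) auto
    moreover have "0 \<le> c" using c by (meson mult_nonneg_nonneg of_nat_0_le_iff order_trans)
    ultimately have "c * 1 \<le> c * (real n powr (2 / 3) * (log 2 (real n))\<^sup>2)"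
      by (intro mult_left_mono) auto
    then show "real r * real n \<le> c * real n powr (2 / 3) * (log 2 (real n))\<^sup>2"
      using c by (simp add: mult.assoc)
  qed simp
  finally have "real (card \<C>) \<le> 2 powr (c * real n powr (2 / 3) * (log 2 (real n))\<^sup>2)" .
  then show ?thesis
    by (intro exI[of _ \<C>]) (auto simp: \<C>_def rainbow_restricted_sum_free_def subtemplate_def)
qed

text \<open>Here \<open>y\<close> is the cube root of \<open>n\<close>. Its lower bound is what 4nr
  \<le> q^2 requires when q is at least y^2/(1536 r^2); the other size conditions follow from it
  with room to spare.\<close>

lemma large_order:
  fixes r n :: nat
  assumes r: "r \<ge> 3"
    and n: "real n = y ^ 3" and y: "y \<ge> 4 * 1536\<^sup>2 * real r ^ 5"
  shows "\<exists>\<C>. \<C> \<subseteq> templates r n \<and>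
      (\<forall>P\<in>templates r n. rainbow_restricted_sum_free n P \<longrightarrow> (\<exists>Q\<in>\<C>. subtemplate n P Q)) \<and>
      (\<forall>P\<in>\<C>. real (RS n P) \<le> real n powr (- (1 / 3)) * real (s {1..n})) \<and>
      real (card \<C>) \<le> 2 powr
        ((2 + 8 * 1536\<^sup>2 * real r ^ 6) * 1536 * real n powr (2 / 3) * (log 2 (real n))\<^sup>2)"
proof -
  define x where "x = real r"
  have x: "x \<ge> 3" using r by (simp add: x_def)
  have x_pow: "1 \<le> x ^ k" for k using x by (intro one_le_power) simp
  have y_ge: "4 * 1536\<^sup>2 * x ^ 5 \<le> y" using y by (simp add: x_def)
  have y_ge': "9437184 * x ^ 5 \<le> y" using y_ge by simp
  have y1: "9437184 \<le> y" using y_ge' x_pow[of 5] by linarith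
  have y_pos: "y > 0" using y1 by simp
  have npow: "real n powr (1 / 3) = y" "real n powr (2 / 3) = y\<^sup>2"
  proof -
    have "real n = y powr 3" using n y_pos by (simp add: powr_realpow)
    then have "real n powr (1 / 3) = y powr 1" "real n powr (2 / 3) = y powr 2"
      by (simp_all add: powr_powr)
    then show "real n powr (1 / 3) = y" "real n powr (2 / 3) = y\<^sup>2" using y_pos by simp_all
  qed
  have n8: "n \<ge> 8"
  proof -
    have "y ^ 1 \<le> y ^ 3" using y1 by (intro power_increasing) auto
    then show ?thesis using y1 n by simp
  qed
  \<comment> \<open>768 = 12 * 64: with RS at most 12 q r^2 n and s([n]) at least n^2/64, this is
    the largest \<open>q\<close> for which these bounds give RS \<le> s([n])/y.\<close>
  define q where "q = nat \<lfloor>y\<^sup>2 / (768 * x\<^sup>2)\<rfloor>"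
  have z1: "1 \<le> y\<^sup>2 / (768 * x\<^sup>2)"
  proof -
    have "x \<le> x ^ 5" using x power_increasing[of 1 5 x] by simp
    then have "768 * x \<le> y" using y_ge' x by linarith
    then have "(768 * x)\<^sup>2 \<le> y\<^sup>2" using x by (intro power_mono) auto
    moreover have "768 * x\<^sup>2 \<le> (768 * x)\<^sup>2" by (simp add: power_mult_distrib)
    ultimately have "768 * x\<^sup>2 \<le> y\<^sup>2" by linarith
    then show ?thesis using x by (simp add: le_divide_eq)
  qed
  have "1 \<le> \<lfloor>y\<^sup>2 / (768 * x\<^sup>2)\<rfloor>" using z1 by (simp only: one_le_floor)
  then have q1: "1 \<le> q" unfolding q_def by linarith
  have q_le: "real q \<le> y\<^sup>2 / (768 * x\<^sup>2)" unfolding q_def using z1 by simp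
  \<comment> \<open>1536 = 2 * 768: rounding down at most halves a number that is at least
    1.\<close>
  have q_ge: "y\<^sup>2 / (1536 * x\<^sup>2) \<le> real q"
  proof -
    have "y\<^sup>2 / (1536 * x\<^sup>2) = y\<^sup>2 / (768 * x\<^sup>2) / 2" by simp
    moreover have "y\<^sup>2 / (768 * x\<^sup>2) - 1 \<le> real q" unfolding q_def by linarith
    moreover have "1 \<le> real q" using q1 by simp
    ultimately show ?thesis by linarith
  qed
  have q2_ge: "y ^ 4 / (1536\<^sup>2 * x ^ 4) \<le> (real q)\<^sup>2"
  proof -
    have "(y\<^sup>2 / (1536 * x\<^sup>2))\<^sup>2 \<le> (real q)\<^sup>2" using q_ge by (intro power_mono) auto
    then show ?thesis by (simp add: power_divide power_mult_distrib flip: power_mult)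
  qed
  have q_n: "6 * q \<le> n"
  proof -
    have "y\<^sup>2 / (768 * x\<^sup>2) \<le> y\<^sup>2 / 768"
      using x_pow[of 2] by (intro divide_left_mono) auto
    then have "6 * real q \<le> y\<^sup>2" using q_le zero_le_power2[of y] by linarith
    also have "\<dots> \<le> y ^ 3" using y1 by (intro power_increasing) auto
    finally show ?thesis using n by linarith
  qed
  have nr: "4 * (n * r) \<le> q\<^sup>2"
  proof -
    have "4 * 1536\<^sup>2 * x ^ 5 * y ^ 3 \<le> y * y ^ 3"
      using y_ge y_pos by (intro mult_right_mono) auto
    moreover have "x ^ 5 = x * x ^ 4" "y ^ 4 = y * y ^ 3" by (simp_all add: eval_nat_numeral)
    ultimately have "4 * y ^ 3 * x * (1536\<^sup>2 * x ^ 4) \<le> y ^ 4" by (simp add: mult_ac)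
    then have "4 * y ^ 3 * x \<le> y ^ 4 / (1536\<^sup>2 * x ^ 4)"
      using x by (subst pos_le_divide_eq) auto
    then have "4 * (real n * real r) \<le> (real q)\<^sup>2"
      using q2_ge by (simp add: n x_def)
    then have "real (4 * (n * r)) \<le> real (q\<^sup>2)" by simp
    then show ?thesis by (simp only: of_nat_le_iff)
  qed
  \<comment> \<open>This is 8 (nr)^2/q^2 with \<open>q\<close> replaced by its lower bound, rounded
    up.\<close>
  define p where "p = nat \<lceil>8 * 1536\<^sup>2 * x ^ 6 * y\<^sup>2\<rceil>"
  have p0: "0 \<le> 8 * 1536\<^sup>2 * x ^ 6 * y\<^sup>2" using x by simp
  have p_ge: "8 * 1536\<^sup>2 * x ^ 6 * y\<^sup>2 \<le> real p" unfolding p_def by linarith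
  have p_le: "real p \<le> 8 * 1536\<^sup>2 * x ^ 6 * y\<^sup>2 + 1" unfolding p_def using p0 by linarith
  have p_q: "8 * (n * r)\<^sup>2 \<le> p * q\<^sup>2"
  proof -
    have "8 * (y ^ 3 * x)\<^sup>2 = 8 * 1536\<^sup>2 * x ^ 6 * y\<^sup>2 * (y ^ 4 / (1536\<^sup>2 * x ^ 4))"
      using x by (simp add: field_simps eval_nat_numeral)
    also have "\<dots> \<le> real p * (real q)\<^sup>2"
      using p_ge q2_ge y_pos x by (intro mult_mono) auto
    finally have "real (8 * (n * r)\<^sup>2) \<le> real (p * q\<^sup>2)" by (simp add: n x_def)
    then show ?thesis by (simp only: of_nat_le_iff)
  qed
  define l where "l = log 2 (real n)"
  have n_pos: "real n > 0" using n8 by simp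
  have n_eq: "2 powr l = real n" using n_pos by (simp add: l_def)
  have l1: "1 \<le> l" unfolding l_def using n8 by (simp add: le_log_iff)
  \<comment> \<open>\<open>2 ^ j\<close> has to exceed 3r (nr)^2 = 3 r^3 n^2, which is below
    n^3.\<close>
  define j where "j = nat \<lceil>3 * l\<rceil>"
  have j: "3 * l \<le> real j" "real j \<le> 4 * l" unfolding j_def using l1 by linarith+
  have n_x: "3 * x ^ 3 < real n" "x * real n + 1 \<le> (real n)\<^sup>2"
  proof -
    have "x ^ 3 \<le> x ^ 5" using x by (intro power_increasing) auto
    then have 1: "4 * x ^ 3 \<le> y" using y_ge' x_pow[of 5] by linarith
    have "y ^ 1 \<le> y ^ 3" using y1 by (intro power_increasing) auto
    then have 2: "4 * x ^ 3 \<le> real n" using 1 n by simp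
    then show "3 * x ^ 3 < real n" using x_pow[of 3] by linarith
    have "x ^ 1 \<le> x ^ 3" using x by (intro power_increasing) auto
    then have "x + 1 \<le> real n" using 2 x by simp
    then have "(x + 1) * real n \<le> real n * real n" using n_pos by (intro mult_right_mono) auto
    then show "x * real n + 1 \<le> (real n)\<^sup>2"
      using n8 by (simp add: power2_eq_square algebra_simps)
  qed
  have j_gt: "3 * r * (n * r)\<^sup>2 < 2 ^ j"
  proof -
    have "real (3 * r * (n * r)\<^sup>2) = (3 * x ^ 3) * (real n)\<^sup>2"
      by (simp add: x_def power2_eq_square power3_eq_cube)
    also have "\<dots> < real n * (real n)\<^sup>2" using n_x(1) n_pos by (intro mult_strict_right_mono) auto
    also have "\<dots> = 2 powr (3 * l)"
      using n_pos by (simp add: n_eq[symmetric] power2_eq_square flip: powr_add)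
    also have "\<dots> \<le> 2 powr real j" using j by simp
    also have "\<dots> = real (2 ^ j)" by (simp add: powr_realpow)
    finally show ?thesis by (simp only: of_nat_less_iff)
  qed
  have "1 \<le> r" using r by simp
  from template_containers[OF this q1 q_n nr p_q j_gt] obtain \<C> where \<C>: "\<C> \<subseteq> templates r n"
    "\<forall>P\<in>templates r n. rainbow_restricted_sum_free n P \<longrightarrow> (\<exists>Q\<in>\<C>. subtemplate n P Q)"
    "\<forall>P\<in>\<C>. RS n P \<le> 12 * q * r\<^sup>2 * n"
    "card \<C> \<le> (n * r + 1) ^ ((q + p) * (192 * j))"
    by blast
  have few: "real (RS n P) \<le> real n powr (- (1 / 3)) * real (s {1..n})" if "P \<in> \<C>" for P
  proof -
    have "RS n P \<le> 12 * q * r\<^sup>2 * n" using \<C>(3) that by blast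
    then have "real (RS n P) \<le> real (12 * q * r\<^sup>2 * n)" by (simp only: of_nat_le_iff)
    also have "\<dots> = real q * (12 * x\<^sup>2 * y ^ 3)" by (simp add: x_def n)
    also have "\<dots> \<le> y\<^sup>2 / (768 * x\<^sup>2) * (12 * x\<^sup>2 * y ^ 3)"
      using q_le y_pos x by (intro mult_right_mono) auto
    also have "\<dots> = inverse y * ((real n)\<^sup>2 / 64)"
      using x y_pos by (simp add: n field_simps eval_nat_numeral)
    also have "\<dots> \<le> inverse y * real (s {1..n})"
      using s_ge[OF n8] y_pos by (intro mult_left_mono) auto
    also have "inverse y = real n powr (- (1 / 3))" by (simp add: powr_minus npow)
    finally show ?thesis .
  qed
  have exponent: "real (q + p) \<le> (2 + 8 * 1536\<^sup>2 * x ^ 6) * y\<^sup>2"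
  proof -
    have "y\<^sup>2 / (768 * x\<^sup>2) \<le> y\<^sup>2 / 1"
      using x_pow[of 2] by (intro divide_left_mono) auto
    moreover have "1 \<le> y\<^sup>2" using y1 by (intro one_le_power) auto
    ultimately show ?thesis using q_le p_le by (simp add: distrib_right)
  qed
  have "real (card \<C>) \<le> real ((n * r + 1) ^ ((q + p) * (192 * j)))"
    using \<C>(4) by (simp only: of_nat_le_iff)
  also have "\<dots> = (x * real n + 1) ^ ((q + p) * (192 * j))" by (simp add: x_def add.commute mult.commute)
  also have "\<dots> \<le> ((real n)\<^sup>2) ^ ((q + p) * (192 * j))"
    using n_x(2) x by (intro power_mono) auto
  also have "\<dots> = (2 powr (2 * l)) powr real ((q + p) * (192 * j))"
  proof -
    have "2 powr (2 * l) = (real n)\<^sup>2"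
      by (simp add: n_eq[symmetric] power2_eq_square flip: powr_add)
    then show ?thesis using n_pos by (simp only: powr_realpow zero_less_power)
  qed
  also have "\<dots> = 2 powr (2 * l * (real (q + p) * (192 * real j)))"
    by (simp only: powr_powr of_nat_mult of_nat_numeral)
  also have "\<dots> \<le> 2 powr (2 * l * ((2 + 8 * 1536\<^sup>2 * x ^ 6) * y\<^sup>2 * (192 * (4 * l))))"
    using exponent j l1 x by (intro powr_mono mult_left_mono mult_mono) auto
  \<comment> \<open>The final 1536 is 2 * 192 * 4, from nr + 1 \<le> n^2, the 192j rounds and j
    \<le> 4l; it is unrelated to the 1536 in the lower bound for \<open>q\<close>.\<close>
  also have "2 * l * ((2 + 8 * 1536\<^sup>2 * x ^ 6) * y\<^sup>2 * (192 * (4 * l)))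
      = (2 + 8 * 1536\<^sup>2 * x ^ 6) * 1536 * y\<^sup>2 * l\<^sup>2"
    by (simp add: power2_eq_square)
  finally have "real (card \<C>) \<le> 2 powr
      ((2 + 8 * 1536\<^sup>2 * real r ^ 6) * 1536 * real n powr (2 / 3) * (log 2 (real n))\<^sup>2)"
    by (simp only: npow l_def x_def)
  then show ?thesis using \<C>(1,2) few by blast
qed

theorem mainTheorem7:
  fixes r :: nat
  assumes "r \<ge> 3"
  shows "\<exists>c::real. \<forall>n::nat. n \<ge> 1 \<longrightarrow>
    (\<exists>\<C>. \<C> \<subseteq> templates r n \<and>
      (\<forall>P\<in>templates r n. rainbow_restricted_sum_free n P \<longrightarrow> (\<exists>Q\<in>\<C>. subtemplate n P Q)) \<and>
      (\<forall>P\<in>\<C>. real (RS n P) \<le> real n powr (- (1 / 3)) * real (s {1..n})) \<and>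
      real (card \<C>) \<le> 2 powr (c * real n powr (2 / 3) * (log 2 (real n))\<^sup>2))"
proof -
  define Y where "Y = 4 * 1536\<^sup>2 * real r ^ 5"
  define c0 where "c0 = (2 + 8 * 1536\<^sup>2 * real r ^ 6) * 1536"
  \<comment> \<open>The second entry covers the orders n \<le> Y^3, for which
    \<open>small_order\<close> asks that \<open>c\<close> be at least rn.\<close>
  define c where "c = max c0 (real r * Y ^ 3)"
  have Y0: "Y \<ge> 0" by (simp add: Y_def)
  show ?thesis
  proof (intro exI[of _ c] allI impI)
    fix n :: nat assume n: "n \<ge> 1"
    define y where "y = real n powr (1 / 3)"
    have "y ^ 3 = y powr real 3" using n by (subst powr_realpow) (simp_all add: y_def)
    then have y: "y ^ 3 = real n" using n by (simp add: y_def powr_powr)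
    show "\<exists>\<C>. \<C> \<subseteq> templates r n \<and>
      (\<forall>P\<in>templates r n. rainbow_restricted_sum_free n P \<longrightarrow> (\<exists>Q\<in>\<C>. subtemplate n P Q)) \<and>
      (\<forall>P\<in>\<C>. real (RS n P) \<le> real n powr (- (1 / 3)) * real (s {1..n})) \<and>
      real (card \<C>) \<le> 2 powr (c * real n powr (2 / 3) * (log 2 (real n))\<^sup>2)"
    proof (cases "y \<ge> Y")
      case False
      then have "y ^ 3 \<le> Y ^ 3" by (intro power_mono) (auto simp: y_def)
      then have "real r * real n \<le> real r * Y ^ 3" unfolding y by (rule mult_left_mono) simp
      then have "real r * real n \<le> c" by (simp add: c_def)
      then show ?thesis by (rule small_order[OF n])
    next
      case True
      then obtain \<C> where \<C>: "\<C> \<subseteq> templates r n"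
        "\<forall>P\<in>templates r n. rainbow_restricted_sum_free n P \<longrightarrow> (\<exists>Q\<in>\<C>. subtemplate n P Q)"
        "\<forall>P\<in>\<C>. real (RS n P) \<le> real n powr (- (1 / 3)) * real (s {1..n})"
        "real (card \<C>) \<le> 2 powr (c0 * real n powr (2 / 3) * (log 2 (real n))\<^sup>2)"
        using large_order[OF assms y[symmetric]] unfolding Y_def c0_def by blast
      have "2 powr (c0 * real n powr (2 / 3) * (log 2 (real n))\<^sup>2)
          \<le> 2 powr (c * real n powr (2 / 3) * (log 2 (real n))\<^sup>2)"
        by (intro powr_mono mult_right_mono) (auto simp: c_def)
      then have "real (card \<C>) \<le> 2 powr (c * real n powr (2 / 3) * (log 2 (real n))\<^sup>2)"
        using \<C>(4) by linarith
      then show ?thesis using \<C>(1-3) by blast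
    qed
  qed
qed

end
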